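(* Let $G=(V,E)$ be a finite simple undirected graph of maximum degree at most $3$, let $M^*$ be a maximum matching of $G$, and let $M$ be the matching output by any run of the \textsc{1-2-MinGreedy} algorithm on $G$. Then $|M|\geq \frac{2}{3}|M^*|$.
   Context: The (deterministic) \textsc{1-2-MinGreedy} algorithm starts with $M=\emptyset$ and repeats until no edges remain in the current graph (initially $G$): if every node has current degree at least $3$, it selects an arbitrary edge $\{u,v\}$; otherwise it selects an arbitrary node $u$ of minimum non-zero current degree and an arbitrary neighbor $v$ of $u$. It then adds $\{u,v\}$ to $M$ and removes all edges incident with $u$ or $v$ from the current graph. All arbitrary choices may be made adversarially; the claim holds for every run. (Every run of the deterministic \textsc{MinGreedy} algorithm, which always selects a node of minimum non-zero current degree and an arbitrary neighbor, is also a run of \textsc{1-2-MinGreedy}.) *)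

theory Defs
  imports Main
begin

definition simple_graph :: "'a set \<Rightarrow> 'a set set \<Rightarrow> bool" where
  "simple_graph V E \<longleftrightarrow> finite V \<and> E \<subseteq> {{u, v} | u v. u \<in> V \<and> v \<in> V \<and> u \<noteq> v}"

definition deg :: "'a set set \<Rightarrow> 'a \<Rightarrow> nat" where
  "deg F u = card {e \<in> F. u \<in> e}"

definition max_degree_le :: "'a set \<Rightarrow> 'a set set \<Rightarrow> nat \<Rightarrow> bool" where
  "max_degree_le V E k \<longleftrightarrow> (\<forall>v\<in>V. deg E v \<le> k)"

definition matching :: "'a set set \<Rightarrow> 'a set set \<Rightarrow> bool" where
  "matching E M \<longleftrightarrow> M \<subseteq> E \<and> (\<forall>e1\<in>M. \<forall>e2\<in>M. e1 \<noteq> e2 \<longrightarrow> e1 \<inter> e2 = {})"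

definition maximum_matching :: "'a set set \<Rightarrow> 'a set set \<Rightarrow> bool" where
  "maximum_matching E M \<longleftrightarrow> matching E M \<and> (\<forall>M'. matching E M' \<longrightarrow> card M' \<le> card M)"

inductive mg12_step :: "'a set set \<times> 'a set set \<Rightarrow> 'a set set \<times> 'a set set \<Rightarrow> bool" where
  any_edge: "\<lbrakk> \<forall>w. deg F w = 0 \<or> deg F w \<ge> 3; {u, v} \<in> F \<rbrakk>
     \<Longrightarrow> mg12_step (F, M) ({e \<in> F. u \<notin> e \<and> v \<notin> e}, insert {u, v} M)"
| min_deg: "\<lbrakk> \<exists>w. deg F w \<noteq> 0 \<and> deg F w < 3; deg F u > 0;
              \<forall>w. deg F w > 0 \<longrightarrow> deg F u \<le> deg F w; {u, v} \<in> F \<rbrakk>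
     \<Longrightarrow> mg12_step (F, M) ({e \<in> F. u \<notin> e \<and> v \<notin> e}, insert {u, v} M)"

definition mg12_output :: "'a set set \<Rightarrow> 'a set set \<Rightarrow> bool" where
  "mg12_output E M \<longleftrightarrow> mg12_step\<^sup>*\<^sup>* (E, {}) ({}, M)"

end

theory Submission
  imports Defs
begin

text \<open>
  Amortised analysis. Fix a matching \<open>N\<close> and give every vertex the weight \<open>2\<close> if the current graph
  still contains its \<open>N\<close>-edge, and \<open>min 2 deg\<close> otherwise. Initially the total weight is at least
  \<open>4 |N|\<close> and at the end it is \<open>0\<close>, so it suffices that every step lowers it by at most \<open>6\<close>.
  A step at minimum degree \<open>2\<close> may lower it by \<open>7\<close>, but only if afterwards there are vertices of
  degree \<open>1\<close> and none of them is matched by \<open>N\<close>; in this situation the next step lowers the weight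
  by at most \<open>5\<close>. A bonus of \<open>1\<close> in the potential accounts for this.
\<close>

definition weight :: "'a set set \<Rightarrow> 'a set set \<Rightarrow> 'a \<Rightarrow> nat" where
  "weight N F w = max (min 2 (deg F w)) (2 * deg (N \<inter> F) w)"

definition bonus :: "'a set set \<Rightarrow> 'a set set \<Rightarrow> nat" where
  "bonus N F = of_bool ((\<exists>w. deg F w = 1) \<and> (\<forall>w. deg F w = 1 \<longrightarrow> deg (N \<inter> F) w = 0))"

definition potential :: "'a set \<Rightarrow> 'a set set \<Rightarrow> 'a set set \<Rightarrow> nat" where
  "potential V N F = (\<Sum>w\<in>V. weight N F w) + bonus N F"

abbreviation delete_ends :: "'a \<Rightarrow> 'a \<Rightarrow> 'a set set \<Rightarrow> 'a set set" where
  "delete_ends u v F \<equiv> {e \<in> F. u \<notin> e \<and> v \<notin> e}"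

lemma bonus_le_1: "bonus N F \<le> 1"
  by (simp add: bonus_def)

section \<open>Degrees in simple graphs and in matchings\<close>

lemma simple_graph_finite: "simple_graph V F \<Longrightarrow> finite F"
  unfolding simple_graph_def by (rule finite_subset[of _ "Pow V"]) auto

lemma simple_graph_mono: "simple_graph V E \<Longrightarrow> F \<subseteq> E \<Longrightarrow> simple_graph V F"
  unfolding simple_graph_def by auto

lemma simple_graph_edge:
  assumes "simple_graph V F" "e \<in> F"
  obtains a b where "e = {a, b}" "a \<in> V" "b \<in> V" "a \<noteq> b"
  using assms unfolding simple_graph_def by blast

lemma deg_mono: "finite F \<Longrightarrow> G \<subseteq> F \<Longrightarrow> deg G w \<le> deg F w"
  unfolding deg_def by (rule card_mono) auto

text \<open>Edges at \<open>u\<close> correspond to their other ends. The indicator form turns later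
  degree comparisons into sums over vertices.\<close>

lemma deg_eq_sum:
  assumes "simple_graph V F"
  shows "deg F u = (\<Sum>t\<in>V. of_bool ({t, u} \<in> F))"
proof -
  have "{e \<in> F. u \<in> e} = (\<lambda>t. {t, u}) ` {t \<in> V. {t, u} \<in> F}"
  proof safe
    fix e assume "e \<in> F" "u \<in> e"
    moreover obtain a b where "e = {a, b}" "a \<in> V" "b \<in> V"
      using simple_graph_edge[OF assms \<open>e \<in> F\<close>] .
    ultimately show "e \<in> (\<lambda>t. {t, u}) ` {t \<in> V. {t, u} \<in> F}"
      by (auto simp: insert_commute)
  qed
  moreover have "inj_on (\<lambda>t. {t, u}) {t \<in> V. {t, u} \<in> F}"
    by (auto simp: inj_on_def doubleton_eq_iff)
  ultimately have "deg F u = card {t \<in> V. {t, u} \<in> F}"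
    by (simp add: deg_def card_image)
  also have "\<dots> = (\<Sum>t\<in>V. of_bool ({t, u} \<in> F))"
    using assms by (simp add: simple_graph_def of_bool_def sum.If_cases Int_def)
  finally show ?thesis .
qed

lemma deg_pos_in_vertices:
  assumes "simple_graph V F" "deg F w > 0"
  shows "w \<in> V"
proof -
  obtain e where "e \<in> F" "w \<in> e"
    using assms(2) by (auto simp: deg_def card_gt_0_iff)
  then show ?thesis
    using simple_graph_edge[OF assms(1)] by (metis insert_iff singletonD)
qed

lemma deg_edge_end:
  assumes "simple_graph V F" "{u, v} \<in> F"
  shows "deg F u = 1 + (\<Sum>t\<in>V - {u, v}. of_bool ({t, u} \<in> F))"
proof -
  have uv: "u \<in> V" "v \<in> V" "u \<noteq> v" and "{u} \<notin> F"
    using assms unfolding simple_graph_def by (auto simp: doubleton_eq_iff)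
  have V: "V = insert u (insert v (V - {u, v}))" using uv by auto
  have "finite V" using assms unfolding simple_graph_def by auto
  then show ?thesis
    unfolding deg_eq_sum[OF assms(1)]
    by (subst V) (use uv assms \<open>{u} \<notin> F\<close> in \<open>simp add: insert_commute\<close>)
qed

lemma deg_delete_ends:
  assumes "simple_graph V F" "u \<noteq> v" "t \<noteq> u" "t \<noteq> v"
  shows "deg F t = deg (delete_ends u v F) t + of_bool ({t, u} \<in> F) + of_bool ({t, v} \<in> F)"
proof -
  have "finite V" using assms unfolding simple_graph_def by auto
  have "deg (delete_ends u v F) t = (\<Sum>s\<in>V. of_bool ({s, t} \<in> delete_ends u v F))"
    by (rule deg_eq_sum[OF simple_graph_mono[OF assms(1)]]) auto
  moreover have "(of_bool ({s, t} \<in> F) :: nat) = of_bool ({s, t} \<in> delete_ends u v F)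
      + (of_bool (s = u \<and> {t, u} \<in> F) + of_bool (s = v \<and> {t, v} \<in> F))" for s
    using assms(2-4) by (auto simp: insert_commute)
  moreover have "(\<Sum>s\<in>V. of_bool (s = w \<and> {t, w} \<in> F)) = (of_bool ({t, w} \<in> F) :: nat)" for w
  proof (cases "{t, w} \<in> F")
    case True
    then have "w \<in> V" using assms(1) unfolding simple_graph_def by (auto simp: doubleton_eq_iff)
    with True \<open>finite V\<close> show ?thesis by (simp add: of_bool_def)
  qed simp
  ultimately show ?thesis
    unfolding deg_eq_sum[OF assms(1), of t] by (simp add: sum.distrib)
qed

lemma deg_matching_le:
  assumes "matching E N"
  shows "deg (N \<inter> F) w \<le> 1"
proof -
  have "\<forall>a\<in>{e \<in> N \<inter> F. w \<in> e}. \<forall>b\<in>{e \<in> N \<inter> F. w \<in> e}. a = b"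
    using assms unfolding matching_def by blast
  then show ?thesis
    unfolding deg_def
    \<comment> \<open>\<open>card\<close> of an infinite set is \<open>0\<close>, so the infinite
      case is immediate.\<close>
    by (cases "finite {e \<in> N \<inter> F. w \<in> e}") (simp_all add: card_le_Suc0_iff_eq)
qed

lemma handshake:
  assumes "simple_graph V F"
  shows "(\<Sum>w\<in>V. deg F w) = 2 * card F"
proof -
  have "finite V" "finite F" 
    using assms simple_graph_finite unfolding simple_graph_def by auto
  have "(\<Sum>w\<in>V. deg F w) = (\<Sum>w\<in>V. \<Sum>e\<in>F. of_bool (w \<in> e))"
    using \<open>finite F\<close> by (simp add: deg_def of_bool_def sum.If_cases Int_def)
  also have "\<dots> = (\<Sum>e\<in>F. \<Sum>w\<in>V. of_bool (w \<in> e))"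
    by (rule sum.swap)
  also have "\<dots> = (\<Sum>e\<in>F. 2)"
  proof (rule sum.cong[OF refl])
    fix e assume "e \<in> F"
    then obtain a b where "e = {a, b}" "a \<in> V" "b \<in> V" "a \<noteq> b"
      by (rule simple_graph_edge[OF assms])
    then have "V \<inter> e = e" "card e = 2" by auto
    then show "(\<Sum>w\<in>V. of_bool (w \<in> e)) = (2 :: nat)"
      using \<open>finite V\<close> by (simp add: of_bool_def sum.If_cases)
  qed
  finally show ?thesis by simp
qed

section \<open>The potential at the start and at the end of a run\<close>

lemma potential_ge:
  assumes "simple_graph V E" "matching E N"
  shows "4 * card N \<le> potential V N E"
proof -
  have "N \<subseteq> E" using assms(2) by (simp add: matching_def)
  \<comment> \<open>Handshake identity for the graph with edge set \<open>N\<close>: each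
    \<open>N\<close>-edge gives weight \<open>2\<close> to both of its ends.\<close>
  then have "4 * card N = (\<Sum>w\<in>V. 2 * deg (N \<inter> E) w)"
    using handshake[OF simple_graph_mono[OF assms(1)], of N]
    by (simp add: Int_absorb2 flip: sum_distrib_left)
  also have "\<dots> \<le> potential V N E"
    unfolding potential_def weight_def by (intro trans_le_add1 sum_mono) simp
  finally show ?thesis .
qed

lemma potential_empty: "potential V N {} = 0"
  by (simp add: potential_def weight_def bonus_def deg_def)

section \<open>The effect of deleting the ends of one selected edge\<close>

locale greedy_step =
  fixes V :: "'a set" and E N F :: "'a set set" and u v :: 'a
  assumes graph: "simple_graph V F"
    and deg_le_3: "deg F w \<le> 3"
    and N: "matching E N"
    and edge: "{u, v} \<in> F"
begin

abbreviation F' :: "'a set set" where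
  "F' \<equiv> delete_ends u v F"

abbreviation adj :: "'a \<Rightarrow> 'a \<Rightarrow> nat" where
  "adj w t \<equiv> of_bool ({t, w} \<in> F)"

lemma ends: "u \<in> V" "v \<in> V" "u \<noteq> v"
  using graph edge unfolding simple_graph_def by (auto simp: doubleton_eq_iff)

lemma finite_V: "finite V"
  using graph by (simp add: simple_graph_def)

lemma deg_N_le: "deg (N \<inter> F) w \<le> deg F w" "deg (N \<inter> F') w \<le> deg F' w"
  using simple_graph_finite[OF graph] by (auto intro: deg_mono)

lemma deg_N_le_1: "deg (N \<inter> F) w \<le> 1"
  using deg_matching_le[OF N] .

lemma deg_F: "t \<in> V - {u, v} \<Longrightarrow> deg F t = deg F' t + adj u t + adj v t"
  using deg_delete_ends[OF graph] ends by auto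

lemma deg_N:
  assumes "t \<in> V - {u, v}"
  shows "deg (N \<inter> F) t
    = deg (N \<inter> F') t + of_bool ({t, u} \<in> N \<inter> F) + of_bool ({t, v} \<in> N \<inter> F)"
proof -
  have "delete_ends u v (N \<inter> F) = N \<inter> F'" by auto
  then show ?thesis
    using deg_delete_ends[OF simple_graph_mono[OF graph, of "N \<inter> F"], of u v t] ends assms
    by simp
qed

lemma weight_le_2: "weight N F w \<le> 2"
  using deg_N_le_1[of w] by (simp add: weight_def)

lemma weight_ge: "min 2 (deg F' w) \<le> weight N F' w"
  by (simp add: weight_def)

lemma weight_zero: "deg F w = 0 \<Longrightarrow> weight N F w = 0"
  using deg_N_le(1)[of w] by (simp add: weight_def)

lemma deg_u: "deg F u = 1 + (\<Sum>t\<in>V - {u, v}. adj u t)"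
  by (rule deg_edge_end[OF graph edge])

lemma deg_v: "deg F v = 1 + (\<Sum>t\<in>V - {u, v}. adj v t)"
  using deg_edge_end[of V F v u] graph edge by (simp add: insert_commute)

lemma split_sum: "(\<Sum>w\<in>V. f w) = f u + f v + (\<Sum>w\<in>V - {u, v}. f w)" for f :: "'a \<Rightarrow> nat"
proof -
  have "V = insert u (insert v (V - {u, v}))" using ends by auto
  then have "(\<Sum>w\<in>V. f w) = (\<Sum>w\<in>insert u (insert v (V - {u, v})). f w)"
    by (rule arg_cong)
  also have "\<dots> = f u + f v + (\<Sum>w\<in>V - {u, v}. f w)" using ends finite_V by simp
  finally show ?thesis .
qed

lemma deg_F'_ends: "deg F' u = 0" "deg F' v = 0"
  by (auto simp: deg_def card_eq_0_iff)

lemma weight_F'_ends: "weight N F' u = 0" "weight N F' v = 0"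
  using deg_F'_ends deg_N_le(2)[of u] deg_N_le(2)[of v] by (simp_all add: weight_def)

text \<open>Splits the loss: \<open>a\<close> bounds what vanishes at the ends \<open>u\<close> and
  \<open>v\<close>, and \<open>b\<close> what the remaining vertices lose.\<close>

lemma potential_le:
  assumes "weight N F u + weight N F v \<le> a"
    and "(\<Sum>t\<in>V - {u, v}. weight N F t) \<le> b + (\<Sum>t\<in>V - {u, v}. weight N F' t)"
    and "a + b + bonus N F \<le> 6 + bonus N F'"
  shows "potential V N F \<le> 6 + potential V N F'"
  using assms unfolding potential_def split_sum weight_F'_ends by linarith

text \<open>All nonzero degrees are \<open>3\<close>, so a vertex outside the edge loses weight only
  if it is adjacent to both ends, and then it loses at most \<open>1\<close>. Charging this to
  \<open>u\<close> gives at most two units.\<close>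

lemma potential_step_deg_3:
  assumes "\<forall>w. deg F w = 0 \<or> deg F w \<ge> 3"
  shows "potential V N F \<le> 6 + potential V N F'"
proof (rule potential_le[where a = 4 and b = 2])
  have "weight N F t \<le> adj u t + weight N F' t" if "t \<in> V - {u, v}" for t
    using deg_F[OF that] weight_ge[of t] weight_le_2[of t] weight_zero[of t] assms[rule_format, of t]
    by (auto simp: of_bool_def split: if_splits)
  then have "(\<Sum>t\<in>V - {u, v}. weight N F t) \<le> (\<Sum>t\<in>V - {u, v}. adj u t + weight N F' t)"
    by (rule sum_mono)
  then show "(\<Sum>t\<in>V - {u, v}. weight N F t) \<le> 2 + (\<Sum>t\<in>V - {u, v}. weight N F' t)"
    using deg_u deg_le_3[of u] by (simp add: sum.distrib)
  have "deg F w \<noteq> 1" for w using assms[rule_format, of w] by auto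
  then show "4 + 2 + bonus N F \<le> 6 + bonus N F'" by (simp add: bonus_def)
qed (use weight_le_2[of u] weight_le_2[of v] in simp)

text \<open>With all nonzero degrees at least \<open>2\<close>, a remaining vertex loses at most one
  unit of weight per deleted edge. There are at most \<open>1 + 2\<close> such edges, so the total
  loss is at most \<open>7\<close>.\<close>

lemma potential_step_deg_2:
  assumes "\<forall>w. deg F w > 0 \<longrightarrow> 2 \<le> deg F w" "deg F u = 2"
  shows "potential V N F \<le> 6 + potential V N F'"
proof -
  let ?R = "V - {u, v}"
  have R: "weight N F t \<le> adj u t + adj v t + weight N F' t" if "t \<in> ?R" for t
    using deg_F[OF that] weight_ge[of t] weight_le_2[of t] weight_zero[of t] assms(1)[rule_format, of t]
    by (cases "deg F t = 0") auto
  have bonus_F: "bonus N F = 0"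
  proof -
    have "deg F w \<noteq> 1" for w using assms(1)[rule_format, of w] by auto
    then show ?thesis by (simp add: bonus_def)
  qed
  have ends_le: "weight N F u + weight N F v \<le> 4"
    using weight_le_2[of u] weight_le_2[of v] by simp
  have sum_u: "(\<Sum>t\<in>?R. adj u t) = 1" using deg_u assms(2) by simp
  have sum_v: "(\<Sum>t\<in>?R. adj v t) \<le> 2" using deg_v deg_le_3[of v] by simp
  have le: "(\<Sum>t\<in>?R. weight N F t) \<le> (\<Sum>t\<in>?R. adj u t + adj v t + weight N F' t)"
    using R by (rule sum_mono)
  show ?thesis
  \<comment> \<open>The loss can be \<open>7\<close> only if \<open>v\<close> has two neighbours
    besides \<open>u\<close>; a new bonus then pays for the seventh unit.\<close>
  proof (cases "bonus N F' = 1 \<or> (\<Sum>t\<in>?R. adj v t) \<le> 1")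
    case True
    have "(\<Sum>t\<in>?R. weight N F t) \<le> (1 + (\<Sum>t\<in>?R. adj v t)) + (\<Sum>t\<in>?R. weight N F' t)"
      using le sum_u by (simp add: sum.distrib)
    then show ?thesis
      by (rule potential_le[OF ends_le]) (use True sum_v bonus_F in auto)
  next
    case False
    then have "(\<Sum>t\<in>?R. adj v t) = 2" "bonus N F' = 0"
      using sum_v bonus_le_1[of N F'] by linarith+
    \<comment> \<open>Without the bonus afterwards, either some vertex of new degree \<open>1\<close> is matched and so keeps
      weight \<open>2\<close>, or a neighbour of \<open>v\<close> alone keeps degree at least \<open>2\<close>.\<close>
    have "\<exists>t\<in>?R. weight N F t < adj u t + adj v t + weight N F' t"
    proof (cases "\<exists>t. deg F' t = 1 \<and> deg (N \<inter> F') t \<noteq> 0")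
      case True
      then obtain t where t: "deg F' t = 1" "deg (N \<inter> F') t \<noteq> 0" by blast
      have "simple_graph V F'" by (rule simple_graph_mono[OF graph]) auto
      then have "t \<in> V" using deg_pos_in_vertices t(1) by fastforce
      moreover have "t \<noteq> u" "t \<noteq> v" using t(1) deg_F'_ends by auto
      ultimately have tR: "t \<in> ?R" by simp
      have "2 \<le> weight N F' t" using t by (simp add: weight_def)
      moreover have "1 \<le> adj u t + adj v t"
        using deg_F[OF tR] t(1) assms(1)[rule_format, of t] by linarith
      ultimately show ?thesis
        using weight_le_2[of t] by (intro bexI[OF _ tR]) linarith
    next
      case no_matched: False
      \<comment> \<open>\<open>v\<close> has two further neighbours and \<open>u\<close> only one,
        so some neighbour of \<open>v\<close> is not adjacent to \<open>u\<close>.\<close>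
      have "\<exists>t\<in>?R. adj u t < adj v t"
      proof (rule ccontr)
        assume "\<not> ?thesis"
        then have "(\<Sum>t\<in>?R. adj v t) \<le> (\<Sum>t\<in>?R. adj u t)"
          by (intro sum_mono) (meson not_le)
        then show False using sum_u \<open>(\<Sum>t\<in>?R. adj v t) = 2\<close> by linarith
      qed
      then obtain t where tR: "t \<in> ?R" and t: "adj u t < adj v t" by blast
      \<comment> \<open>No vertex of new degree \<open>1\<close> is matched, so a missing bonus
        means that there is no vertex of degree \<open>1\<close> at all.\<close>
      have "deg F' t \<noteq> 1"
        using \<open>bonus N F' = 0\<close> no_matched unfolding bonus_def by auto
      moreover have "deg F t = deg F' t + 1"
        using deg_F[OF tR] t by (auto simp: of_bool_def split: if_splits)
      ultimately have "2 \<le> deg F' t"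
        using assms(1)[rule_format, of t] by linarith
      then show ?thesis
        using weight_ge[of t] weight_le_2[of t] t by (intro bexI[OF _ tR]) linarith
    qed
    then have "(\<Sum>t\<in>?R. weight N F t) < (\<Sum>t\<in>?R. adj u t + adj v t + weight N F' t)"
      using R finite_V by (intro sum_strict_mono_ex1) auto
    then have "(\<Sum>t\<in>?R. weight N F t) \<le> 2 + (\<Sum>t\<in>?R. weight N F' t)"
      using sum_u sum_v by (simp add: sum.distrib)
    then show ?thesis
      by (rule potential_le[OF ends_le]) (use bonus_F in auto)
  qed
qed

text \<open>Only \<open>v\<close> has neighbours among the other vertices, at most two. The ends
  lose \<open>4\<close> if \<open>u\<close> is matched by \<open>N\<close> and \<open>3\<close>
  otherwise; the unit saved covers either an existing bonus or the \<open>N\<close>-partner of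
  \<open>v\<close>, which may lose \<open>2\<close>.\<close>

lemma potential_step_deg_1:
  assumes "deg F u = 1"
  shows "potential V N F \<le> 6 + potential V N F'"
proof -
  let ?R = "V - {u, v}"
  have not_adj_u: "{t, u} \<notin> F" if "t \<in> ?R" for t
    using assms deg_u finite_V that by auto
  have deg_R: "deg F t = deg F' t + adj v t" if "t \<in> ?R" for t
    using deg_F[OF that] not_adj_u[OF that] by simp
  have deg_N_R: "deg (N \<inter> F) t = deg (N \<inter> F') t + of_bool ({t, v} \<in> N \<inter> F)"
    if "t \<in> ?R" for t
    using deg_N[OF that] not_adj_u[OF that] by simp
  have sum_v: "(\<Sum>t\<in>?R. adj v t) \<le> 2" using deg_v deg_le_3[of v] by simp
  have sum_N: "deg (N \<inter> F) v
      = of_bool ({u, v} \<in> N) + (\<Sum>t\<in>?R. of_bool ({t, v} \<in> N \<inter> F))"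
  proof -
    have "{v} \<notin> F" using graph unfolding simple_graph_def by (auto simp: doubleton_eq_iff)
    have "simple_graph V (N \<inter> F)" by (rule simple_graph_mono[OF graph]) auto
    from deg_eq_sum[OF this, of v] show ?thesis
      unfolding split_sum using edge \<open>{v} \<notin> F\<close> by simp
  qed
  have weight_u: "weight N F u = 1 + deg (N \<inter> F) u"
    using assms deg_N_le_1[of u] by (auto simp: weight_def)
  have sum_le: "(\<Sum>t\<in>?R. weight N F t) \<le> 2 + (\<Sum>t\<in>?R. weight N F' t)"
    if "\<And>t. t \<in> ?R \<Longrightarrow> weight N F t \<le> adj v t + weight N F' t"
  proof -
    have "(\<Sum>t\<in>?R. weight N F t) \<le> (\<Sum>t\<in>?R. adj v t + weight N F' t)"
      using that by (rule sum_mono)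
    then show ?thesis using sum_v by (simp add: sum.distrib)
  qed
  show ?thesis
  proof (cases "deg (N \<inter> F) u = 0")
    case False
    then obtain e where e: "e \<in> N" "e \<in> F" "u \<in> e"
      by (auto simp: deg_def card_eq_0_iff)
    have "card {e \<in> F. u \<in> e} = 1" using assms by (simp add: deg_def)
    then have "e = {u, v}"
      using e edge by (metis (mono_tags, lifting) card_1_singletonE insertI1 mem_Collect_eq singletonD)
    then have "{u, v} \<in> N" using e by simp
    \<comment> \<open>The \<open>N\<close>-edge at \<open>v\<close> is \<open>{u, v}\<close> itself,
      so no other vertex loses its \<open>N\<close>-edge.\<close>
    have "{t, v} \<notin> N \<inter> F" if "t \<in> ?R" for t
      using sum_N deg_N_le_1[of v] \<open>{u, v} \<in> N\<close> finite_V that by auto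
    then have "weight N F t \<le> adj v t + weight N F' t" if "t \<in> ?R" for t
      using deg_R[OF that] deg_N_R[OF that] that by (auto simp: weight_def)
    then show ?thesis
    proof (intro potential_le[where a = 4 and b = 2] sum_le)
      \<comment> \<open>\<open>u\<close> is a matched vertex of degree \<open>1\<close>, which rules
        out a bonus before the step.\<close>
      show "4 + 2 + bonus N F \<le> 6 + bonus N F'"
        using False assms by (auto simp: bonus_def)
    qed (use weight_le_2[of u] weight_le_2[of v] in auto)
  next
    case True
    then have ends_le: "weight N F u + weight N F v \<le> 3"
      using weight_u weight_le_2[of v] by simp
    show ?thesis
    proof (cases "bonus N F = 0")
      case False
      then have unmatched: "deg F t \<noteq> 1 \<or> deg (N \<inter> F) t = 0" for t
        by (auto simp: bonus_def)
      \<comment> \<open>Under the bonus, an \<open>N\<close>-partner of \<open>v\<close> has degree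
        at least \<open>2\<close>, so it keeps weight at least \<open>1\<close> after losing its
        \<open>N\<close>-edge.\<close>
      have "weight N F t \<le> adj v t + weight N F' t" if "t \<in> ?R" for t
        using deg_R[OF that] deg_N_R[OF that] unmatched[of t] weight_le_2[of t] weight_zero[of t]
        by (auto simp: weight_def of_bool_def split: if_splits)
      then show ?thesis
        by (intro potential_le[OF ends_le, where b = 2] sum_le) (auto simp: bonus_def)
    next
      case bonus: True
      \<comment> \<open>The extra indicator allows for an \<open>N\<close>-partner of
        \<open>v\<close> of degree \<open>1\<close>, which drops from \<open>2\<close> to
        \<open>0\<close>. There is at most one such partner.\<close>
      have "weight N F t \<le> adj v t + of_bool ({t, v} \<in> N \<inter> F) + weight N F' t"
        if "t \<in> ?R" for t
        using deg_R[OF that] deg_N_R[OF that] deg_N_le_1[of t]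
        by (auto simp: weight_def of_bool_def split: if_splits)
      then have "(\<Sum>t\<in>?R. weight N F t)
          \<le> (\<Sum>t\<in>?R. adj v t + of_bool ({t, v} \<in> N \<inter> F) + weight N F' t)"
        by (rule sum_mono)
      then have "(\<Sum>t\<in>?R. weight N F t) \<le> 3 + (\<Sum>t\<in>?R. weight N F' t)"
        using sum_v sum_N deg_N_le_1[of v] unfolding sum.distrib by linarith
      then show ?thesis
        by (rule potential_le[OF ends_le]) (use bonus in simp)
    qed
  qed
qed

end

section \<open>Summing the losses over a run\<close>

lemma mg12_step_edge:
  assumes "mg12_step (F, M) (F', M')"
  obtains u v where "{u, v} \<in> F" "F' = delete_ends u v F" "M' = insert {u, v} M"
  using assms by cases auto

lemma potential_step:
  assumes "simple_graph V F" "\<And>w. deg F w \<le> 3" "matching E N"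
    and "mg12_step (F, M) (F', M')"
  shows "potential V N F \<le> 6 + potential V N F'"
  using assms(4)
proof cases
  case (any_edge u v)
  interpret greedy_step V E N F u v using assms(1-3) any_edge by unfold_locales auto
  show ?thesis using potential_step_deg_3 any_edge by simp
next
  case (min_deg u v)
  interpret greedy_step V E N F u v using assms(1-3) min_deg by unfold_locales auto
  obtain w where "deg F w \<noteq> 0" "deg F w < 3" using min_deg by blast
  then have "deg F u = 1 \<or> deg F u = 2" using min_deg(4) min_deg(5)[rule_format, of w] by linarith
  then show ?thesis using potential_step_deg_1 potential_step_deg_2 min_deg by auto
qed

text \<open>Generalised to an arbitrary intermediate state so that induction can peel off the first
  step. Disjointness of \<open>F\<close> and \<open>M\<^sub>0\<close> ensures that each step adds a
  new edge.\<close>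

lemma mg12_run_card:
  assumes "mg12_step\<^sup>*\<^sup>* (F, M\<^sub>0) ({}, M)"
    and "simple_graph V F" "\<And>w. deg F w \<le> 3" "matching E N" "finite M\<^sub>0" "F \<inter> M\<^sub>0 = {}"
  shows "6 * card M\<^sub>0 + potential V N F \<le> 6 * card M"
  using assms(1-3,5-6)
proof (induction rule: converse_rtranclp_induct2)
  case refl
  show ?case by (simp add: potential_empty)
next
  case (step F M\<^sub>0 F' M\<^sub>1)
  obtain u v where uv: "{u, v} \<in> F" "F' = delete_ends u v F" "M\<^sub>1 = insert {u, v} M\<^sub>0"
    using step.hyps(1) by (rule mg12_step_edge)
  have sub: "F' \<subseteq> F" using uv by auto
  have "deg F' w \<le> 3" for w
    using deg_mono[OF simple_graph_finite[OF step.prems(1)] sub] step.prems(2) le_trans by blast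
  then have "6 * card M\<^sub>1 + potential V N F' \<le> 6 * card M"
    using step.prems sub uv by (intro step.IH simple_graph_mono[OF _ sub]) auto
  moreover have "{u, v} \<notin> M\<^sub>0" using uv step.prems by blast
  then have "card M\<^sub>1 = card M\<^sub>0 + 1" using uv step.prems by simp
  moreover have "potential V N F \<le> 6 + potential V N F'"
    using potential_step[OF step.prems(1,2) assms(4) step.hyps(1)] .
  ultimately show ?case by simp
qed

theorem theorem1:
  fixes V :: "'a set" and E Mstar M :: "'a set set"
  assumes "simple_graph V E"
    and "max_degree_le V E 3"
    and "maximum_matching E Mstar"
    and "mg12_output E M"
  shows "3 * card M \<ge> 2 * card Mstar"
proof -
  have N: "matching E Mstar" using assms(3) by (simp add: maximum_matching_def)
  \<comment> \<open>The degree hypothesis speaks of \<open>V\<close> only; elsewhere the degree is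
    \<open>0\<close>.\<close>
  have "deg E w \<le> 3" for w
    using assms(2) deg_pos_in_vertices[OF assms(1), of w]
    by (cases "deg E w = 0") (auto simp: max_degree_le_def)
  then have "potential V Mstar E \<le> 6 * card M"
    using mg12_run_card[of E "{}" M V E Mstar] assms(1,4) N by (simp add: mg12_output_def)
  with potential_ge[OF assms(1) N] show ?thesis by simp
qed

end
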